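(* There is a monotone function $\eta$ such that for every hypergraph $H$, every rooted tree decomposition $\mathbf{t}$ of $H$ and every elimination forest $F$ of $H$, the chromatic number of the conflict graph $\mathrm{CG}(\mathbf{t},F)$ is at most $\eta(\mathrm{split}(\mathbf{t},F),\mathrm{mir}(\mathbf{t},F),\mathrm{tw}(\mathbf{t}),\mathrm{rank}(H))$.
   Context: Hypergraph $H$: finite $V(H)$, edges non-empty subsets, each vertex in some edge; $\mathrm{rank}(H)$ = max edge size; vertices are adjacent if some edge contains both. A rooted tree decomposition $\mathbf{t}=(T,\mathrm{bag})$: rooted tree $T$, bags covering every edge, each vertex's bags forming a connected subtree; $\mathrm{tw}(\mathbf{t})=\max|\mathrm{bag}(x)|-1$. For node $x$ with parent $p$: $\mathrm{adh}(x)=\mathrm{bag}(x)\cap\mathrm{bag}(p)$ ($\emptyset$ at the root), $\mathrm{mrg}(x)=\mathrm{bag}(x)\setminus\mathrm{adh}(x)$, $\mathrm{cmp}(x)=\bigcup_{y\text{ descendant of }x}\mathrm{mrg}(y)$. For $u\in V(H)$, $\mathrm{mn}(u)$ is the unique node $x$ with $u\in\mathrm{mrg}(x)$. An elimination forest $F$ of $H$: rooted forest on $V(H)$ in which any two vertices of a common edge are in ancestor–descendant relation. Factors of a rooted forest ($F_x$ = descendants of $x$ incl. $x$): tree factor $F_x$; forest factor = non-empty union of tree factors with sibling roots; context factor $F_x\setminus B$ with $B$ a forest factor whose roots are strict descendants of $x$. $\mathrm{MF}(U)$ = inclusion-maximal factors contained in $U$; $U$ is well-formed if $\mathrm{MF}(U)$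 has no context factor. $\mathrm{split}(\mathbf{t},F)=\max_x|\mathrm{MF}(\mathrm{cmp}(x))|$; the irregularity of node $x$ is the number of children $y$ with $\mathrm{cmp}(y)$ not well-formed; $\mathrm{mir}(\mathbf{t},F)$ is its maximum. The stain of $u\in V(H)$ is $\mathrm{Stain}(u)=\{\mathrm{mn}(u)\}\cup\bigcup_{v \text{ child of } u \text{ in } F}\mathrm{Path}(u,v)$, where $\mathrm{Path}(u,v)$ is the vertex set of the path in $T$ from $\mathrm{mn}(u)$ to $\mathrm{mn}(v)$. The conflict graph $\mathrm{CG}(\mathbf{t},F)$ has vertex set $V(H)$, with distinct $u,v$ adjacent iff their stains intersect. *)

theory Defs
  imports "Graph_Theory.Digraph_Component" "Graph_Theory.Vertex_Walk"
begin

section \<open>Hypergraphs\<close>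

record 'a hypergraph =
  hverts :: "'a set"
  hedges :: "'a set set"

definition hypergraph :: "'a hypergraph \<Rightarrow> bool" where
  "hypergraph H \<longleftrightarrow> finite (hverts H) \<and>
     (\<forall>e\<in>hedges H. e \<noteq> {} \<and> e \<subseteq> hverts H) \<and> (\<forall>v\<in>hverts H. \<exists>e\<in>hedges H. v \<in> e)"

text \<open>The rank of the hypergraph without edges is \<open>0\<close>.\<close>

definition hrank :: "'a hypergraph \<Rightarrow> nat" where
  "hrank H = Max (insert 0 (card ` hedges H))"


section \<open>Rooted forests and trees\<close>

text \<open>
  A finite rooted forest is a digraph whose arcs lead from parents to children. Hence ``\<open>y\<close> is a
  (not necessarily strict) descendant of \<open>x\<close>'' is reachability of \<open>y\<close> from \<open>x\<close>, and the undirected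
  forest is the underlying symmetric graph \<open>mk_symmetric\<close>.
\<close>

definition parents :: "'a pair_pre_digraph \<Rightarrow> 'a \<Rightarrow> 'a set" where
  "parents F x = {p. (p, x) \<in> parcs F}"

definition children :: "'a pair_pre_digraph \<Rightarrow> 'a \<Rightarrow> 'a set" where
  "children F x = {y. (x, y) \<in> parcs F}"

definition rooted_forest :: "'a pair_pre_digraph \<Rightarrow> bool" where
  "rooted_forest F \<longleftrightarrow> pair_fin_digraph F \<and> acyclic (parcs F) \<and>
     (\<forall>x p q. p \<in> parents F x \<and> q \<in> parents F x \<longrightarrow> p = q)"

text \<open>\<open>connected\<close> excludes the null graph, so a rooted tree has exactly one root.\<close>

definition rooted_tree :: "'a pair_pre_digraph \<Rightarrow> bool" where
  "rooted_tree T \<longleftrightarrow> rooted_forest T \<and> connected (with_proj T)"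

definition descendants :: "'a pair_pre_digraph \<Rightarrow> 'a \<Rightarrow> 'a set" where
  "descendants F x = {y. x \<rightarrow>\<^sup>*\<^bsub>with_proj F\<^esub> y}"

definition path_verts :: "'a pair_pre_digraph \<Rightarrow> 'a \<Rightarrow> 'a \<Rightarrow> 'a set" where
  "path_verts T x y =
     set (THE p. vpath p (with_proj (mk_symmetric (with_proj T))) \<and> hd p = x \<and> last p = y)"


section \<open>Factors of a rooted forest\<close>

text \<open>Siblings have the same parent; the roots of the forest are siblings of each other.\<close>

definition siblings :: "'a pair_pre_digraph \<Rightarrow> 'a set \<Rightarrow> bool" where
  "siblings F R \<longleftrightarrow> R \<subseteq> pverts F \<and> (\<forall>x\<in>R. \<forall>y\<in>R. parents F x = parents F y)"

definition tree_factor :: "'a pair_pre_digraph \<Rightarrow> 'a set \<Rightarrow> bool" where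
  "tree_factor F A \<longleftrightarrow> (\<exists>x\<in>pverts F. A = descendants F x)"

definition forest_factor :: "'a pair_pre_digraph \<Rightarrow> 'a set \<Rightarrow> bool" where
  "forest_factor F A \<longleftrightarrow>
     (\<exists>R. R \<noteq> {} \<and> siblings F R \<and> A = (\<Union>r\<in>R. descendants F r))"

definition context_factor :: "'a pair_pre_digraph \<Rightarrow> 'a set \<Rightarrow> bool" where
  "context_factor F A \<longleftrightarrow>
     (\<exists>x\<in>pverts F. \<exists>R. R \<noteq> {} \<and> siblings F R \<and> (\<forall>r\<in>R. x \<rightarrow>\<^sup>+\<^bsub>with_proj F\<^esub> r) \<and>
        A = descendants F x - (\<Union>r\<in>R. descendants F r))"

definition factor :: "'a pair_pre_digraph \<Rightarrow> 'a set \<Rightarrow> bool" where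
  "factor F A \<longleftrightarrow> tree_factor F A \<or> forest_factor F A \<or> context_factor F A"

definition MF :: "'a pair_pre_digraph \<Rightarrow> 'a set \<Rightarrow> 'a set set" where
  "MF F U = {A. factor F A \<and> A \<subseteq> U \<and> \<not> (\<exists>B. factor F B \<and> B \<subseteq> U \<and> A \<subset> B)}"

definition well_formed :: "'a pair_pre_digraph \<Rightarrow> 'a set \<Rightarrow> bool" where
  "well_formed F U \<longleftrightarrow> \<not> (\<exists>A\<in>MF F U. context_factor F A)"


section \<open>Elimination forests and tree decompositions\<close>

definition elimination_forest :: "'a hypergraph \<Rightarrow> 'a pair_pre_digraph \<Rightarrow> bool" where
  "elimination_forest H F \<longleftrightarrow> rooted_forest F \<and> pverts F = hverts H \<and>
     (\<forall>e\<in>hedges H. \<forall>u\<in>e. \<forall>v\<in>e. v \<in> descendants F u \<or> u \<in> descendants F v)"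

record ('a, 'b) tree_decomp =
  dtree :: "'b pair_pre_digraph"
  bag :: "'b \<Rightarrow> 'a set"

definition tree_decomposition :: "'a hypergraph \<Rightarrow> ('a, 'b) tree_decomp \<Rightarrow> bool" where
  "tree_decomposition H t \<longleftrightarrow> rooted_tree (dtree t) \<and>
     (\<forall>x\<in>pverts (dtree t). bag t x \<subseteq> hverts H) \<and>
     (\<forall>e\<in>hedges H. \<exists>x\<in>pverts (dtree t). e \<subseteq> bag t x) \<and>
     (\<forall>u\<in>hverts H. connected (with_proj (dtree t) \<restriction> {x \<in> pverts (dtree t). u \<in> bag t x}))"

text \<open>The width is \<open>-1\<close> if all bags are empty, hence an integer.\<close>

definition tw :: "('a, 'b) tree_decomp \<Rightarrow> int" where
  "tw t = Max ((\<lambda>x. int (card (bag t x)) - 1) ` pverts (dtree t))"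

text \<open>In a rooted tree, the union in \<open>adh\<close> is the bag of the parent, and it is empty at the root.\<close>

definition adh :: "('a, 'b) tree_decomp \<Rightarrow> 'b \<Rightarrow> 'a set" where
  "adh t x = bag t x \<inter> (\<Union>p\<in>parents (dtree t) x. bag t p)"

definition mrg :: "('a, 'b) tree_decomp \<Rightarrow> 'b \<Rightarrow> 'a set" where
  "mrg t x = bag t x - adh t x"

definition cmp :: "('a, 'b) tree_decomp \<Rightarrow> 'b \<Rightarrow> 'a set" where
  "cmp t x = (\<Union>y\<in>descendants (dtree t) x. mrg t y)"

definition mn :: "('a, 'b) tree_decomp \<Rightarrow> 'a \<Rightarrow> 'b" where
  "mn t u = (THE x. x \<in> pverts (dtree t) \<and> u \<in> mrg t x)"

definition split :: "('a, 'b) tree_decomp \<Rightarrow> 'a pair_pre_digraph \<Rightarrow> nat" where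
  "split t F = Max ((\<lambda>x. card (MF F (cmp t x))) ` pverts (dtree t))"

definition irregularity :: "('a, 'b) tree_decomp \<Rightarrow> 'a pair_pre_digraph \<Rightarrow> 'b \<Rightarrow> nat" where
  "irregularity t F x = card {y \<in> children (dtree t) x. \<not> well_formed F (cmp t y)}"

definition mir :: "('a, 'b) tree_decomp \<Rightarrow> 'a pair_pre_digraph \<Rightarrow> nat" where
  "mir t F = Max (irregularity t F ` pverts (dtree t))"


section \<open>The conflict graph\<close>

definition stain :: "('a, 'b) tree_decomp \<Rightarrow> 'a pair_pre_digraph \<Rightarrow> 'a \<Rightarrow> 'b set" where
  "stain t F u = {mn t u} \<union> (\<Union>v\<in>children F u. path_verts (dtree t) (mn t u) (mn t v))"

definition conflict_graph ::
  "'a hypergraph \<Rightarrow> ('a, 'b) tree_decomp \<Rightarrow> 'a pair_pre_digraph \<Rightarrow> 'a pair_pre_digraph" where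
  "conflict_graph H t F =
     \<lparr> pverts = hverts H,
       parcs = {(u, v). u \<in> hverts H \<and> v \<in> hverts H \<and> u \<noteq> v \<and> stain t F u \<inter> stain t F v \<noteq> {}} \<rparr>"

definition proper_colouring :: "'a pair_pre_digraph \<Rightarrow> nat \<Rightarrow> ('a \<Rightarrow> nat) \<Rightarrow> bool" where
  "proper_colouring G k c \<longleftrightarrow>
     (\<forall>v\<in>pverts G. c v < k) \<and> (\<forall>u v. (u, v) \<in> parcs G \<longrightarrow> c u \<noteq> c v)"

definition chromatic_number :: "'a pair_pre_digraph \<Rightarrow> nat" where
  "chromatic_number G = (LEAST k. \<exists>c. proper_colouring G k c)"

end

theory Submission
  imports Defs
begin

text \<open>
  Each stain is the node set of a subtree of \<open>T\<close>, so the conflict graph is chordal: if two stains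
  meet, then the one whose topmost node is higher contains the topmost node of the other. Colouring
  greedily by the depth of the topmost nodes, it suffices to bound the number of stains through a
  node \<open>x\<close>. If the path from \<open>mn u\<close> to \<open>mn v\<close>, with \<open>v\<close> a child of \<open>u\<close>, meets \<open>x\<close> and neither \<open>u\<close>
  nor \<open>v\<close> lies in the bag of \<open>x\<close>, then either exactly one of \<open>u\<close> and \<open>v\<close> lies in \<open>cmp x\<close>, or \<open>u\<close>
  lies in \<open>cmp y\<close> and \<open>v\<close> does not, for some child \<open>y\<close> of \<open>x\<close>. Only one vertex of \<open>F\<close> can have an
  arc leaving a given factor, and only one can have an arc entering it; moreover, only context
  factors have outgoing arcs, so \<open>cmp y\<close> is not well-formed in the last case. Hence at most
  \<open>2 (tw + 1) + 2 split + mir split\<close> stains contain \<open>x\<close>.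
\<close>

section \<open>Walks, bridges and connected sets\<close>

text \<open>At most one link crosses the boundary of \<open>C\<close>: a bridge with outer end
  \<open>a\<close> and inner end \<open>c\<close>. No such link need exist, so a whole component is
  covered too.\<close>

definition separates :: "'a rel \<Rightarrow> 'a set \<Rightarrow> 'a \<Rightarrow> 'a \<Rightarrow> bool" where
  "separates E C a c \<longleftrightarrow>
     (\<forall>i j. (i, j) \<in> E \<and> i \<notin> C \<and> j \<in> C \<longrightarrow> i = a \<and> j = c) \<and>
     (\<forall>i j. (i, j) \<in> E \<and> i \<in> C \<and> j \<notin> C \<longrightarrow> i = c \<and> j = a)"

lemma separates_Compl: "separates E C a c \<Longrightarrow> separates E (- C) c a"
  unfolding separates_def by blast

text \<open>Some step of the walk passes from outside into \<open>C\<close>, and only the bridge can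
  be that step.\<close>

lemma walk_enters:
  assumes "set (vwalk_arcs p) \<subseteq> E" "p \<noteq> []" "hd p \<notin> C" "last p \<in> C" "separates E C a c"
  shows "a \<in> set p \<and> c \<in> set p"
  using assms
proof (induction p rule: vwalk_arcs.induct)
  case (3 x y xs)
  show ?case
  proof (cases "y \<in> C")
    case True
    then have "x = a \<and> y = c" using 3 unfolding separates_def by auto
    then show ?thesis by simp
  next
    case False
    then show ?thesis using 3 by auto
  qed
qed auto

text \<open>A walk that leaves \<open>C\<close> does so from \<open>c\<close> and has to come back
  through \<open>c\<close>, so a path cannot leave and return.\<close>

lemma path_stays:
  assumes "set (vwalk_arcs p) \<subseteq> E" "p \<noteq> []" "distinct p" "hd p \<in> C" "last p \<in> C"
    "separates E C a c"
  shows "set p \<subseteq> C"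
  using assms
proof (induction p rule: vwalk_arcs.induct)
  case (3 x y xs)
  show ?case
  proof (cases "y \<in> C")
    case True
    then show ?thesis using 3 by auto
  next
    case False
    then have "x = c" using 3 unfolding separates_def by auto
    moreover have "c \<in> set (y # xs)"
      using walk_enters[of "y # xs" E C a c] False 3 by auto
    ultimately show ?thesis using 3 by auto
  qed
qed auto

text \<open>The first link of \<open>p\<close> is a bridge that separates the common start from the
  common end. So \<open>q\<close> has to cross it as well, and can do so only in its first
  step.\<close>

lemma path_unique:
  assumes "set (vwalk_arcs p) \<subseteq> E" "p \<noteq> []" "distinct p"
    and "set (vwalk_arcs q) \<subseteq> E" "q \<noteq> []" "distinct q"
    and "hd p = hd q" "last p = last q"
    and bridges: "\<And>a c. (a, c) \<in> E \<Longrightarrow> \<exists>C. separates E C a c \<and> a \<notin> C \<and> c \<in> C"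
  shows "p = q"
  using assms(1-8)
proof (induction p arbitrary: q rule: vwalk_arcs.induct)
  case (2 x)
  then obtain q' where "q = x # q'" by (cases q) auto
  then show ?case using 2 by (cases q') (auto split: if_splits)
next
  case (3 x y xs)
  obtain q' where q: "q = x # q'" using "3.prems" by (cases q) auto
  have "q' \<noteq> []" using "3.prems" q by (auto split: if_splits)
  obtain C where C: "separates E C x y" "x \<notin> C" "y \<in> C" using bridges[of x y] "3.prems" by auto
  \<comment> \<open>Otherwise the rest of \<open>p\<close>, which starts at \<open>y\<close> in
    \<open>C\<close>, would leave \<open>C\<close> through \<open>x\<close> and repeat
    \<open>x\<close>.\<close>
  have "last (y # xs) \<in> C"
  proof (rule ccontr)
    assume "last (y # xs) \<notin> C"
    then show False
      using walk_enters[of "y # xs" E "- C" y x] separates_Compl[OF C(1)] "3.prems" C by auto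
  qed
  then have last: "last q' \<in> C" using "3.prems" q \<open>q' \<noteq> []\<close> by auto
  have sub: "set (vwalk_arcs q') \<subseteq> E" using "3.prems" q \<open>q' \<noteq> []\<close> by (cases q') auto
  \<comment> \<open>If \<open>q'\<close> started outside \<open>C\<close>, it would enter through
    \<open>x\<close>, which \<open>q\<close> has already used.\<close>
  have "hd q' \<in> C"
    using walk_enters[of q' E C x y] last sub C "3.prems" q \<open>q' \<noteq> []\<close> by auto
  moreover have "(x, hd q') \<in> E" using "3.prems" q \<open>q' \<noteq> []\<close> by (cases q') auto
  ultimately have "hd q' = y" using C unfolding separates_def by blast
  then have "y # xs = q'" using "3.prems" sub q \<open>q' \<noteq> []\<close> by (intro "3.IH") auto
  then show ?case using q by simp
qed auto

text \<open>For symmetric \<open>E\<close> the set \<open>S\<close> induces a connected subgraph.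
  The empty set counts as connected here, so non-emptiness is stated separately where it
  matters.\<close>

definition conn_in :: "'a rel \<Rightarrow> 'a set \<Rightarrow> bool" where
  "conn_in E S \<longleftrightarrow> (\<forall>a\<in>S. \<forall>b\<in>S. (a, b) \<in> (E \<inter> S \<times> S)\<^sup>*)"

lemma conn_in_crossing:
  assumes "conn_in E S" "a \<in> S" "a \<in> C" "b \<in> S" "b \<notin> C"
  obtains i j where "(i, j) \<in> E" "i \<in> S" "j \<in> S" "i \<in> C" "j \<notin> C"
proof -
  have "(a, b) \<in> (E \<inter> S \<times> S)\<^sup>*" using assms unfolding conn_in_def by blast
  then have "b \<notin> C \<Longrightarrow> \<exists>i j. (i, j) \<in> E \<and> i \<in> S \<and> j \<in> S \<and> i \<in> C \<and> j \<notin> C"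
    using \<open>a \<in> C\<close> by (induction rule: rtrancl_induct) blast+
  then show thesis using assms that by blast
qed

lemma conn_in_star:
  assumes "sym E" and "\<And>b. b \<in> S \<Longrightarrow> (x, b) \<in> (E \<inter> S \<times> S)\<^sup>*"
  shows "conn_in E S"
proof -
  have "sym ((E \<inter> S \<times> S)\<^sup>*)" using \<open>sym E\<close> by (intro sym_rtrancl) (auto simp: sym_def)
  then have "(a, x) \<in> (E \<inter> S \<times> S)\<^sup>*" if "a \<in> S" for a
    using assms(2)[OF that] by (rule symD)
  then show ?thesis unfolding conn_in_def using assms(2) by (blast intro: rtrancl_trans)
qed

lemma conn_in_walk:
  assumes "sym E" "set (vwalk_arcs p) \<subseteq> E"
  shows "conn_in E (set p)"
proof (rule conn_in_star[OF \<open>sym E\<close>])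
  fix b assume "b \<in> set p"
  then show "(hd p, b) \<in> (E \<inter> set p \<times> set p)\<^sup>*"
    using assms(2)
  proof (induction p rule: vwalk_arcs.induct)
    case (3 x y xs)
    show ?case
    proof (cases "b = x")
      case False
      then have "(y, b) \<in> (E \<inter> set (y # xs) \<times> set (y # xs))\<^sup>*" using 3 by auto
      then have "(y, b) \<in> (E \<inter> set (x # y # xs) \<times> set (x # y # xs))\<^sup>*"
        by (rule set_rev_mp) (intro rtrancl_mono, auto)
      moreover have "(x, y) \<in> E \<inter> set (x # y # xs) \<times> set (x # y # xs)" using 3 by auto
      ultimately show ?thesis by (metis list.sel(1) converse_rtrancl_into_rtrancl)
    qed auto
  qed auto
qed

lemma conn_in_UN:
  assumes "sym E" and "\<And>S. S \<in> \<S> \<Longrightarrow> conn_in E S \<and> x \<in> S"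
  shows "conn_in E (\<Union>\<S>)"
proof (rule conn_in_star[OF \<open>sym E\<close>])
  fix b assume "b \<in> \<Union>\<S>"
  then obtain S where S: "S \<in> \<S>" "b \<in> S" by blast
  then have "(x, b) \<in> (E \<inter> S \<times> S)\<^sup>*" using assms(2) unfolding conn_in_def by blast
  then show "(x, b) \<in> (E \<inter> \<Union>\<S> \<times> \<Union>\<S>)\<^sup>*"
    using S by (elim set_rev_mp) (intro rtrancl_mono, auto)
qed

text \<open>Colour in order of increasing \<open>f\<close>: the neighbours coloured before
  \<open>u\<close> all satisfy \<open>f v \<le> f u\<close>, so fewer than \<open>k\<close> colours
  are blocked. Ties count for both vertices, so any order among them works.\<close>

lemma greedy_colouring:
  fixes f :: "'a \<Rightarrow> nat"
  assumes "finite V" "symp adj"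
    and "\<And>u. u \<in> V \<Longrightarrow> card {v \<in> V. v \<noteq> u \<and> adj u v \<and> f v \<le> f u} < k"
  shows "\<exists>c :: 'a \<Rightarrow> nat. (\<forall>v\<in>V. c v < k) \<and> (\<forall>u\<in>V. \<forall>v\<in>V. u \<noteq> v \<and> adj u v \<longrightarrow> c u \<noteq> c v)"
  using assms(1,3)
proof (induction V rule: finite_psubset_induct)
  case (psubset V)
  show ?case
  proof (cases "V = {}")
    case False
    obtain u where u: "u \<in> V" "\<And>v. v \<in> V \<Longrightarrow> f v \<le> f u"
    proof -
      have "Max (f ` V) \<in> f ` V" using False psubset(1) by simp
      then obtain u where "u \<in> V" "f u = Max (f ` V)" by auto
      then show thesis using psubset(1) that by simp
    qed
    \<comment> \<open>Deleting the last vertex \<open>u\<close> only shrinks the counted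
      neighbourhoods, so the induction hypothesis applies.\<close>
    have "card {v \<in> V - {u}. v \<noteq> w \<and> adj w v \<and> f v \<le> f w} < k" if "w \<in> V - {u}" for w
    proof -
      have "card {v \<in> V - {u}. v \<noteq> w \<and> adj w v \<and> f v \<le> f w}
          \<le> card {v \<in> V. v \<noteq> w \<and> adj w v \<and> f v \<le> f w}"
        using psubset(1) by (intro card_mono) auto
      then show ?thesis using psubset(3)[of w] that by simp
    qed
    then obtain c :: "'a \<Rightarrow> nat" where c: "\<forall>v\<in>V - {u}. c v < k"
        "\<forall>w\<in>V - {u}. \<forall>v\<in>V - {u}. w \<noteq> v \<and> adj w v \<longrightarrow> c w \<noteq> c v"
      using psubset(2)[of "V - {u}"] u by blast
    let ?N = "{v \<in> V. v \<noteq> u \<and> adj u v}"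
    \<comment> \<open>Since \<open>f u\<close> is maximal, the hypothesis bounds the whole
      neighbourhood of \<open>u\<close>.\<close>
    have "?N = {v \<in> V. v \<noteq> u \<and> adj u v \<and> f v \<le> f u}" using u by auto
    then have "card ?N < k" using psubset(3)[OF u(1)] by simp
    then have "card (c ` ?N) < card {..<k}"
      using card_image_le[of ?N c] psubset(1) by simp
    then have "\<not> {..<k} \<subseteq> c ` ?N"
      using card_mono[of "c ` ?N" "{..<k}"] psubset(1) by auto
    then obtain n where n: "n < k" "n \<notin> c ` ?N" by auto
    show ?thesis
    proof (intro exI[of _ "c(u := n)"] conjI ballI impI)
      fix v w assume vw: "v \<in> V" "w \<in> V" "v \<noteq> w \<and> adj v w"
      then have "adj w v" using \<open>symp adj\<close> by (meson sympD)
      then show "(c(u := n)) v \<noteq> (c(u := n)) w" using vw c n by auto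
    qed (use c n in auto)
  qed auto
qed

lemma card_UN_bounded:
  assumes "finite I" "card I \<le> n" "\<And>i. i \<in> I \<Longrightarrow> card (B i) \<le> k"
  shows "card (\<Union>i\<in>I. B i) \<le> n * k"
proof -
  have "card (\<Union>i\<in>I. B i) \<le> (\<Sum>i\<in>I. card (B i))" using assms(1) by (rule card_UN_le)
  also have "\<dots> \<le> card I * k" using sum_bounded_above[of I "\<lambda>i. card (B i)" k] assms(3) by simp
  also have "\<dots> \<le> n * k" using assms(2) by simp
  finally show ?thesis .
qed


section \<open>Rooted forests\<close>

lemma parcs_mk_symmetric_pair:
  "parcs (mk_symmetric (with_proj G)) = parcs G \<union> (parcs G)\<inverse>"
  by (auto simp: parcs_mk_symmetric)

locale rooted_forest_graph =
  fixes F :: "'a pair_pre_digraph"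
  assumes rooted_forest: "rooted_forest F"
begin

abbreviation links :: "'a rel" where
  "links \<equiv> parcs F \<union> (parcs F)\<inverse>"

lemma sym_links: "sym links"
  by (auto simp: sym_def)

sublocale pair_fin_digraph F
  using rooted_forest by (simp add: rooted_forest_def)

section \<open>Unique parents and the order of descendants\<close>

lemma parent_unique: "(p, x) \<in> parcs F \<Longrightarrow> (q, x) \<in> parcs F \<Longrightarrow> p = q"
  using rooted_forest by (simp add: rooted_forest_def parents_def)

lemma acyclic: "acyclic (parcs F)"
  using rooted_forest by (simp add: rooted_forest_def)

text \<open>Reachability in a digraph is reflexive only on its vertices, \<open>rtrancl\<close>
  everywhere; hence the condition on \<open>x\<close>.\<close>

lemma descendants_iff: "y \<in> descendants F x \<longleftrightarrow> x \<in> pverts F \<and> (x, y) \<in> (parcs F)\<^sup>*"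
proof
  assume "y \<in> descendants F x"
  then show "x \<in> pverts F \<and> (x, y) \<in> (parcs F)\<^sup>*"
    unfolding descendants_def reachable_def
    by (auto dest: rtrancl_on_rtranclI in_rtrancl_on_in_F)
next
  assume *: "x \<in> pverts F \<and> (x, y) \<in> (parcs F)\<^sup>*"
  then have "(x, y) \<in> (parcs F)\<^sup>*" by simp
  then have "y \<in> pverts F" using * by (induction) (auto dest: in_arcsD2)
  then show "y \<in> descendants F x"
    unfolding descendants_def reachable_def
    using * by (auto intro: rtrancl_consistent_rtrancl_on dest: in_arcsD2)
qed

lemma descendants_refl: "x \<in> pverts F \<Longrightarrow> x \<in> descendants F x"
  by (simp add: descendants_iff)

lemma descendants_subset: "descendants F x \<subseteq> pverts F"
  unfolding descendants_def by (auto elim: reachable_in_vertsE)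

lemma descendants_trans:
  "y \<in> descendants F x \<Longrightarrow> z \<in> descendants F y \<Longrightarrow> z \<in> descendants F x"
  by (auto simp: descendants_iff)

lemma descendants_arc: "y \<in> descendants F x \<Longrightarrow> (y, z) \<in> parcs F \<Longrightarrow> z \<in> descendants F x"
  by (auto simp: descendants_iff)

text \<open>The last arc of a non-trivial descent to \<open>y\<close> comes from the only parent of
  \<open>y\<close>.\<close>

lemma descendants_parent:
  "y \<in> descendants F x \<Longrightarrow> y \<noteq> x \<Longrightarrow> (p, y) \<in> parcs F \<Longrightarrow> p \<in> descendants F x"
  by (auto simp: descendants_iff elim: rtranclE dest: parent_unique)

lemma arc_not_descendant: "(x, y) \<in> parcs F \<Longrightarrow> x \<notin> descendants F y"
  using acyclic by (auto simp: descendants_iff acyclic_def dest: rtrancl_into_trancl2)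

lemma descendants_antisym: "y \<in> descendants F x \<Longrightarrow> x \<in> descendants F y \<Longrightarrow> x = y"
  using acyclic by (metis acyclic_def descendants_iff rtranclD trancl_rtrancl_trancl)

text \<open>Parents are unique, so the ancestors of \<open>z\<close> form a chain. In the induction
  along the descent from \<open>x\<close>, the parent of the current endpoint stays below
  \<open>y\<close> until the endpoint is \<open>y\<close> itself.\<close>

lemma descendants_comparable:
  assumes "z \<in> descendants F x" "z \<in> descendants F y"
  shows "x \<in> descendants F y \<or> y \<in> descendants F x"
proof -
  have "(x, z) \<in> (parcs F)\<^sup>*" using assms by (simp add: descendants_iff)
  then show ?thesis using assms(2)
  proof (induction rule: rtrancl_induct)
    case (step p z)
    show ?case
    proof (cases "z = y")
      case True
      then have "(x, y) \<in> (parcs F)\<^sup>*" using step by auto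
      then show ?thesis using assms(1) by (simp add: descendants_iff)
    next
      case False
      then show ?thesis using step descendants_parent by blast
    qed
  qed simp
qed

text \<open>A subtree is closed under children and, except at its root, under parents. So a link can
  cross its boundary only at the root.\<close>

lemma descendants_enter:
  assumes "(i, j) \<in> links" "i \<notin> descendants F x" "j \<in> descendants F x"
  shows "j = x \<and> (i, x) \<in> parcs F"
  using assms descendants_parent descendants_arc by blast

lemma separates_descendants:
  assumes "(p, x) \<in> parcs F"
  shows "separates links (descendants F x) p x"
  unfolding separates_def
  using descendants_enter assms parent_unique sym_links by (meson symD)

lemma ex_separates_descendants: "\<exists>p. separates links (descendants F x) p x"
proof (cases "\<exists>p. (p, x) \<in> parcs F")
  case True
  then show ?thesis using separates_descendants by blast
next
  \<comment> \<open>Without a parent of \<open>x\<close> no link crosses the boundary, so any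
    \<open>p\<close> will do.\<close>
  case False
  then show ?thesis unfolding separates_def using descendants_enter sym_links by (meson symD)
qed

text \<open>Removing a link cuts off the subtree below its lower end. That subtree serves for a
  downward link, its complement for an upward one.\<close>

lemma links_bridge:
  assumes "(a, c) \<in> links"
  shows "\<exists>C. separates links C a c \<and> a \<notin> C \<and> c \<in> C"
proof (cases "(a, c) \<in> parcs F")
  case True
  then show ?thesis
    using separates_descendants arc_not_descendant descendants_refl in_arcsD2 by blast
next
  case False
  then have "(c, a) \<in> parcs F" using assms by blast
  then show ?thesis
    using separates_Compl[OF separates_descendants] arc_not_descendant descendants_refl in_arcsD2
    by blast
qed

text \<open>By well-foundedness some \<open>r\<close> in \<open>S\<close> has no parent in
  \<open>S\<close>. A link out of the subtree of \<open>r\<close> leads to that parent, so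
  \<open>S\<close> cannot leave the subtree.\<close>

lemma conn_in_top:
  assumes "conn_in links S" "S \<noteq> {}" "S \<subseteq> pverts F"
  obtains r where "r \<in> S" "S \<subseteq> descendants F r"
proof -
  have "wf (parcs F)" using pair_finite_arcs acyclic by (rule finite_acyclic_wf)
  then obtain r where r: "r \<in> S" "\<And>p. (p, r) \<in> parcs F \<Longrightarrow> p \<notin> S"
    using \<open>S \<noteq> {}\<close> by (metis ex_in_conv wfE_min)
  have "S \<subseteq> descendants F r"
  proof (rule ccontr)
    assume "\<not> S \<subseteq> descendants F r"
    then obtain b where "b \<in> S" "b \<notin> descendants F r" by blast
    then obtain i j where "(i, j) \<in> links" "j \<in> S" "i \<in> descendants F r" "j \<notin> descendants F r"
      using conn_in_crossing[OF assms(1) r(1) descendants_refl] r(1) assms(3) by blast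
    then show False using descendants_enter[of j i r] r(2) by blast
  qed
  then show thesis using r that by blast
qed

text \<open>Unless \<open>x = r\<close>, a chain inside \<open>S\<close> from \<open>z\<close> to
  \<open>r\<close> has to leave the subtree of \<open>x\<close>, and the only link that does so
  starts at \<open>x\<close>.\<close>

lemma conn_in_convex:
  assumes "conn_in links S" "r \<in> S" "z \<in> S" "z \<in> descendants F x" "x \<in> descendants F r"
  shows "x \<in> S"
proof (cases "r \<in> descendants F x")
  case True
  then show ?thesis using assms descendants_antisym by metis
next
  case False
  then obtain i j where "(i, j) \<in> links" "i \<in> S" "i \<in> descendants F x" "j \<notin> descendants F x"
    using conn_in_crossing[OF assms(1) assms(3,4) assms(2)] by blast
  then show ?thesis using descendants_enter[of j i x] by blast
qed


section \<open>Arcs leaving or entering a factor\<close>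

text \<open>Tree and forest factors are unions of full subtrees, hence closed under children. This
  is what turns leaving arcs into irregularity.\<close>

lemma leaving_arc_context:
  assumes "factor F A" "(u, v) \<in> parcs F" "u \<in> A" "v \<notin> A"
  shows "context_factor F A"
proof -
  have "\<exists>R. A = (\<Union>r\<in>R. descendants F r)" if "tree_factor F A \<or> forest_factor F A"
    using that unfolding tree_factor_def forest_factor_def by auto
  moreover have "A \<noteq> (\<Union>r\<in>R. descendants F r)" for R
    using assms(2-4) descendants_arc by blast
  ultimately show ?thesis using assms(1) unfolding factor_def by blast
qed

text \<open>The arcs that leave a context factor lead to roots of the removed forest. These are
  siblings and share their parent.\<close>

lemma leaving_unique:
  assumes "factor F A" "(u, v) \<in> parcs F" "u \<in> A" "v \<notin> A" "(u', v') \<in> parcs F" "u' \<in> A" "v' \<notin> A"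
  shows "u = u'"
proof -
  obtain x R where R: "siblings F R" "A = descendants F x - (\<Union>r\<in>R. descendants F r)"
    using leaving_arc_context[OF assms(1-4)] unfolding context_factor_def by blast
  \<comment> \<open>If \<open>w\<close> were strictly below a removed root, its parent
    \<open>z\<close> would be removed as well.\<close>
  have *: "w \<in> R" if zw: "(z, w) \<in> parcs F" "z \<in> A" "w \<notin> A" for z w
  proof -
    have "w \<in> descendants F x" using zw R(2) descendants_arc by blast
    then obtain r where r: "r \<in> R" "w \<in> descendants F r" using zw R(2) by blast
    then have "z \<notin> descendants F r" using zw R(2) by blast
    then show "w \<in> R" using r zw(1) descendants_parent by blast
  qed
  have "parents F v = parents F v'"
    using R(1) *[OF assms(2-4)] *[OF assms(5-7)] unfolding siblings_def by blast
  then show ?thesis using assms(2,5) parent_unique unfolding parents_def by blast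
qed

text \<open>Entering arcs end at roots of the factor. A tree or context factor has a single root,
  and the roots of a forest factor are siblings.\<close>

lemma entering_unique:
  assumes "factor F A" "(u, v) \<in> parcs F" "u \<notin> A" "v \<in> A" "(u', v') \<in> parcs F" "u' \<notin> A" "v' \<in> A"
  shows "u = u'"
proof -
  have "\<exists>S. siblings F S \<and> (\<forall>z w. (z, w) \<in> parcs F \<and> z \<notin> A \<and> w \<in> A \<longrightarrow> w \<in> S)"
    using assms(1) unfolding factor_def
  proof (elim disjE)
    assume "tree_factor F A"
    then obtain x where "x \<in> pverts F" "A = descendants F x" unfolding tree_factor_def by blast
    then show ?thesis
      using descendants_parent by (intro exI[of _ "{x}"]) (auto simp: siblings_def)
  next
    assume "forest_factor F A"
    then obtain R where "siblings F R" "A = (\<Union>r\<in>R. descendants F r)"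
      unfolding forest_factor_def by blast
    then show ?thesis using descendants_parent by (intro exI[of _ R]) blast
  next
    assume "context_factor F A"
    then obtain x R where "x \<in> pverts F" "A = descendants F x - (\<Union>r\<in>R. descendants F r)"
      unfolding context_factor_def by blast
    \<comment> \<open>An arc to any other vertex of \<open>A\<close> would have to start in the
      removed part, which is closed under children.\<close>
    moreover have "w = x" if "(z, w) \<in> parcs F" "z \<notin> A" "w \<in> A" for z w
    proof (rule ccontr)
      assume "w \<noteq> x"
      then have "z \<in> descendants F x" using that calculation descendants_parent by blast
      then show False using that calculation descendants_arc by blast
    qed
    ultimately show ?thesis by (intro exI[of _ "{x}"]) (auto simp: siblings_def)
  qed
  then have "parents F v = parents F v'"
    using assms unfolding siblings_def by blast
  then show ?thesis using assms(2,5) parent_unique unfolding parents_def by blast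
qed

text \<open>A leaf is a tree factor; an inner vertex is the context factor left after removing the
  trees of all its children. Hence factors inside a set of vertices cover it.\<close>

lemma singleton_factor:
  assumes "u \<in> pverts F"
  shows "factor F {u}"
proof (cases "children F u = {}")
  case True
  then have "y = u" if "(u, y) \<in> (parcs F)\<^sup>*" for y
    using that by (auto simp: children_def elim: converse_rtranclE)
  then have "descendants F u = {u}" using assms by (auto simp: descendants_iff)
  then show ?thesis using assms unfolding factor_def tree_factor_def by blast
next
  case False
  have "siblings F (children F u)"
    using parent_unique in_arcsD2 by (auto simp: siblings_def children_def parents_def)
  moreover have "{u} = descendants F u - (\<Union>r\<in>children F u. descendants F r)"
  proof -
    have "y = u \<or> (\<exists>r\<in>children F u. y \<in> descendants F r)" if "y \<in> descendants F u" for y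
    proof -
      have "(u, y) \<in> (parcs F)\<^sup>*" using that by (simp add: descendants_iff)
      then show ?thesis
        by (rule converse_rtranclE) (auto simp: descendants_iff children_def dest: in_arcsD2)
    qed
    moreover have "u \<notin> descendants F r" if "r \<in> children F u" for r
      using that arc_not_descendant by (simp add: children_def)
    ultimately show ?thesis using assms descendants_refl by blast
  qed
  ultimately have "context_factor F {u}"
    using assms False unfolding context_factor_def
    by (intro bexI[of _ u] exI[of _ "children F u"]) (auto simp: children_def)
  then show ?thesis by (simp add: factor_def)
qed

text \<open>By finiteness, the factor \<open>{u}\<close> extends to a maximal factor inside
  \<open>U\<close>.\<close>

lemma MF_cover:
  assumes "u \<in> U" "U \<subseteq> pverts F"
  obtains A where "A \<in> MF F U" "u \<in> A"
proof -
  let ?\<A> = "{A. factor F A \<and> A \<subseteq> U}"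
  have "finite ?\<A>"
    using assms(2) pair_finite_verts by (intro finite_subset[of ?\<A> "Pow (pverts F)"]) auto
  moreover have "{u} \<in> ?\<A>" using assms singleton_factor by blast
  ultimately obtain A where A: "A \<in> ?\<A>" "{u} \<subseteq> A" "\<forall>B\<in>?\<A>. A \<subseteq> B \<longrightarrow> A = B"
    using finite_has_maximal2 by (metis (no_types, lifting))
  then have "A \<in> MF F U" unfolding MF_def by blast
  then show thesis using A that by blast
qed

lemma finite_MF: "U \<subseteq> pverts F \<Longrightarrow> finite (MF F U)"
  by (rule finite_subset[of _ "Pow (pverts F)"]) (auto simp: MF_def)

text \<open>The tails are collected instead of the arcs: many arcs may cross the boundary of a
  factor, but they share their tail, and it is the tail that carries the stain.\<close>

definition out_verts :: "'a set \<Rightarrow> 'a set" where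
  "out_verts A = {u \<in> A. \<exists>v. (u, v) \<in> parcs F \<and> v \<notin> A}"

definition in_verts :: "'a set \<Rightarrow> 'a set" where
  "in_verts A = {u. u \<notin> A \<and> (\<exists>v. (u, v) \<in> parcs F \<and> v \<in> A)}"

lemma out_verts_bound:
  assumes "factor F A"
  shows "finite (out_verts A) \<and> card (out_verts A) \<le> 1"
proof -
  have "\<exists>u. out_verts A \<subseteq> {u}"
    using leaving_unique[OF assms] unfolding out_verts_def by blast
  then obtain u where u: "out_verts A \<subseteq> {u}" ..
  show ?thesis using card_mono[OF _ u] finite_subset[OF u] by simp
qed

lemma in_verts_bound:
  assumes "factor F A"
  shows "finite (in_verts A) \<and> card (in_verts A) \<le> 1"
proof -
  have "\<exists>u. in_verts A \<subseteq> {u}"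
    using entering_unique[OF assms] unfolding in_verts_def by blast
  then obtain u where u: "in_verts A \<subseteq> {u}" ..
  show ?thesis using card_mono[OF _ u] finite_subset[OF u] by simp
qed

end


section \<open>Stains\<close>

locale decomposition =
  fixes H :: "'a hypergraph" and t :: "('a, 'b) tree_decomp" and F :: "'a pair_pre_digraph"
  assumes decomposition: "tree_decomposition H t"
    and elimination: "elimination_forest H F"
begin

abbreviation T :: "'b pair_pre_digraph" where
  "T \<equiv> dtree t"

abbreviation V :: "'a set" where
  "V \<equiv> hverts H"

sublocale T: rooted_forest_graph T
  using decomposition by unfold_locales (simp add: tree_decomposition_def rooted_tree_def)

sublocale F: rooted_forest_graph F
  using elimination by unfold_locales (simp add: elimination_forest_def)

lemma pverts_F: "pverts F = V"
  using elimination by (simp add: elimination_forest_def)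

lemma finite_V: "finite V"
  using F.pair_finite_verts by (simp add: pverts_F)

lemma bag_subset: "x \<in> pverts T \<Longrightarrow> bag t x \<subseteq> V"
  using decomposition by (simp add: tree_decomposition_def)

text \<open>This justifies the definite description in \<open>path_verts\<close>: connectedness of
  \<open>T\<close> gives a path, and the bridges make it unique.\<close>

lemma path_in_T:
  assumes "a \<in> pverts T" "b \<in> pverts T"
  obtains p where "path_verts T a b = set p" "p \<noteq> []" "hd p = a" "last p = b" "distinct p"
    "set p \<subseteq> pverts T" "set (vwalk_arcs p) \<subseteq> T.links"
proof -
  let ?S = "with_proj (mk_symmetric (with_proj T))"
  let ?P = "\<lambda>p. vpath p ?S \<and> hd p = a \<and> last p = b"
  interpret S: pair_wf_digraph "mk_symmetric (with_proj T)"
    using T.wellformed_mk_symmetric .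
  have arcs: "set p \<subseteq> pverts T \<and> set (vwalk_arcs p) \<subseteq> T.links \<and> p \<noteq> [] \<and> distinct p"
    if "?P p" for p
    using that by (auto simp: vpath_def vwalk_def parcs_mk_symmetric_pair)
  have "a \<rightarrow>\<^sup>*\<^bsub>?S\<^esub> b"
    using decomposition assms
    by (simp add: tree_decomposition_def rooted_tree_def connected_def strongly_connected_def)
  then obtain p where p: "?P p" using S.reachable_vpath_conv by blast
  have "q = p" if "?P q" for q
    using path_unique[of q T.links p] arcs[OF that] arcs[OF p] that p T.links_bridge by simp
  then have "(THE p. ?P p) = p" using p by (rule_tac the_equality)
  then have "path_verts T a b = set p" by (simp add: path_verts_def)
  then show thesis using that arcs[OF p] p by blast
qed

section \<open>The nodes \<open>mn\<close> and the sets \<open>mrg\<close> and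
  \<open>cmp\<close>\<close>

lemma bags_conn:
  assumes "u \<in> V"
  defines "S \<equiv> {x \<in> pverts T. u \<in> bag t x}"
  shows "conn_in T.links S \<and> S \<noteq> {}"
proof -
  let ?S = "mk_symmetric (with_proj T \<restriction> S)"
  have sc: "strongly_connected (with_proj ?S)"
    using decomposition assms by (simp add: tree_decomposition_def connected_def)
  have sub: "parcs ?S \<subseteq> T.links \<inter> S \<times> S"
    by (auto simp: parcs_mk_symmetric)
  have "(a, b) \<in> (T.links \<inter> S \<times> S)\<^sup>*" if "a \<in> S" "b \<in> S" for a b
  proof -
    have "a \<rightarrow>\<^sup>*\<^bsub>with_proj ?S\<^esub> b" using sc that by (simp add: strongly_connected_def)
    then have "(a, b) \<in> (parcs ?S)\<^sup>*" using reachable_rtranclI by force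
    then show ?thesis using rtrancl_mono[OF sub] by blast
  qed
  then show ?thesis using sc by (auto simp: conn_in_def strongly_connected_def)
qed

text \<open>The nodes whose bags contain \<open>u\<close> form a subtree of \<open>T\<close>, and
  \<open>u\<close> is in the margin exactly at those of them whose parent is not one of them. Only
  the top of the subtree is such a node.\<close>

lemma ex1_mrg:
  assumes "u \<in> V"
  shows "\<exists>!x. x \<in> pverts T \<and> u \<in> mrg t x"
proof -
  let ?S = "{x \<in> pverts T. u \<in> bag t x}"
  obtain r where r: "r \<in> ?S" "?S \<subseteq> descendants T r"
    using bags_conn[OF assms] T.conn_in_top[of ?S] by auto
  have mrg_iff: "u \<in> mrg t x \<longleftrightarrow> u \<in> bag t x \<and> (\<forall>p. (p, x) \<in> parcs T \<longrightarrow> u \<notin> bag t p)" for x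
    by (auto simp: mrg_def adh_def parents_def)
  have "u \<in> mrg t r"
    using r T.arc_not_descendant T.in_arcsD1 unfolding mrg_iff by blast
  moreover have "x = r" if x: "x \<in> pverts T" "u \<in> mrg t x" for x
  proof (rule ccontr)
    assume "x \<noteq> r"
    have "x \<in> ?S" using x mrg_iff by simp
    then have "x \<in> descendants T r" using r by blast
    then obtain p where p: "(p, x) \<in> parcs T"
      using \<open>x \<noteq> r\<close> by (auto simp: T.descendants_iff elim: rtranclE)
    then have "p \<in> descendants T r"
      using \<open>x \<in> descendants T r\<close> \<open>x \<noteq> r\<close> T.descendants_parent by blast
    \<comment> \<open>The parent of \<open>x\<close> lies between \<open>x\<close> and the top
      \<open>r\<close>, so convexity applies.\<close>
    then have "p \<in> ?S"
      using T.conn_in_convex[of ?S r x p] bags_conn[OF assms] r \<open>x \<in> ?S\<close> p T.in_arcsD1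
        T.descendants_arc T.descendants_refl by blast
    then show False using x p mrg_iff by blast
  qed
  ultimately show ?thesis using r(1) by (intro ex1I[of _ r]) auto
qed

lemma mn_mrg: "u \<in> V \<Longrightarrow> mn t u \<in> pverts T \<and> u \<in> mrg t (mn t u)"
  unfolding mn_def by (rule theI') (rule ex1_mrg)

lemma mn_eqI: "u \<in> V \<Longrightarrow> x \<in> pverts T \<Longrightarrow> u \<in> mrg t x \<Longrightarrow> mn t u = x"
  using ex1_mrg mn_mrg by blast

lemma mn_bag: "u \<in> V \<Longrightarrow> u \<in> bag t (mn t u)"
  using mn_mrg by (auto simp: mrg_def)

lemma cmp_iff: "u \<in> V \<Longrightarrow> u \<in> cmp t x \<longleftrightarrow> mn t u \<in> descendants T x"
  unfolding cmp_def using mn_mrg mn_eqI T.descendants_subset by blast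

lemma cmp_subset: "cmp t x \<subseteq> pverts F"
  unfolding cmp_def mrg_def pverts_F using bag_subset T.descendants_subset by blast

text \<open>All the paths in a stain start at \<open>mn t u\<close>, so their union is connected;
  the singleton takes care of leaves of \<open>F\<close>.\<close>

lemma stain_conn:
  assumes "u \<in> V"
  shows "conn_in T.links (stain t F u) \<and> mn t u \<in> stain t F u \<and> stain t F u \<subseteq> pverts T"
proof -
  let ?\<S> = "insert {mn t u} ((\<lambda>v. path_verts T (mn t u) (mn t v)) ` children F u)"
  have "conn_in T.links S \<and> mn t u \<in> S \<and> S \<subseteq> pverts T" if "S \<in> ?\<S>" for S
    using that
  proof
    assume "S = {mn t u}"
    then show ?thesis using mn_mrg[OF assms] by (simp add: conn_in_def)
  next
    assume "S \<in> (\<lambda>v. path_verts T (mn t u) (mn t v)) ` children F u"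
    then obtain v where v: "v \<in> children F u" "S = path_verts T (mn t u) (mn t v)" by blast
    then have "v \<in> V" using F.in_arcsD2 by (auto simp: children_def pverts_F)
    then obtain p where "S = set p" "p \<noteq> []" "hd p = mn t u" "set p \<subseteq> pverts T"
        "set (vwalk_arcs p) \<subseteq> T.links"
      using path_in_T[of "mn t u" "mn t v"] mn_mrg assms v(2) by metis
    then show ?thesis using conn_in_walk[OF T.sym_links] hd_in_set[of p] by simp
  qed
  moreover have "stain t F u = \<Union>?\<S>" by (auto simp: stain_def)
  ultimately show ?thesis using conn_in_UN[OF T.sym_links, of ?\<S> "mn t u"] by auto
qed

text \<open>A path with both ends on one side of a subtree boundary stays on that side. For the
  subtree of \<open>x\<close> this forces an end into it. If both ends are there and
  \<open>a \<noteq> x\<close>, take the child \<open>y\<close> of \<open>x\<close> towards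
  \<open>a\<close>: \<open>b\<close> cannot be below \<open>y\<close>, or the path would miss
  \<open>x\<close>.\<close>

lemma path_cases:
  assumes "x \<in> path_verts T a b" "a \<in> pverts T" "b \<in> pverts T"
  obtains (lower) "a \<in> descendants T x" "b \<notin> descendants T x"
    | (upper) "a \<notin> descendants T x" "b \<in> descendants T x"
    | (left) "a = x"
    | (right) "b = x"
    | (child) y where "y \<in> children T x" "a \<in> descendants T y" "b \<notin> descendants T y"
proof -
  obtain p where p: "path_verts T a b = set p" "p \<noteq> []" "hd p = a" "last p = b" "distinct p"
    "set p \<subseteq> pverts T" "set (vwalk_arcs p) \<subseteq> T.links"
    using path_in_T[OF assms(2,3)] .
  have stays: "set p \<subseteq> C" if "separates T.links C c d" "a \<in> C" "b \<in> C" for C c d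
    using path_stays[OF p(7,2,5)] that p by blast
  have x: "x \<in> set p" "x \<in> pverts T" using assms(1) p by auto
  have "a \<in> descendants T x \<or> b \<in> descendants T x"
  proof (rule ccontr)
    assume "\<not> ?thesis"
    moreover obtain c where "separates T.links (descendants T x) c x"
      using T.ex_separates_descendants by blast
    ultimately have "set p \<subseteq> - descendants T x"
      using stays[OF separates_Compl] by simp
    then show False using x T.descendants_refl by blast
  qed
  moreover have ?thesis if both: "a \<in> descendants T x" "b \<in> descendants T x" "a \<noteq> x"
  proof -
    have "(x, a) \<in> (parcs T)\<^sup>*" using both by (simp add: T.descendants_iff)
    then obtain y where "(x, y) \<in> parcs T" "(y, a) \<in> (parcs T)\<^sup>*"
      using both(3) by (metis converse_rtranclE)
    then have y: "(x, y) \<in> parcs T" "a \<in> descendants T y"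
      using T.in_arcsD2 by (auto simp: T.descendants_iff)
    have "b \<notin> descendants T y"
      using stays[OF T.separates_descendants[OF y(1)] y(2)] x(1) T.arc_not_descendant[OF y(1)]
      by blast
    then show ?thesis using y child by (simp add: children_def)
  qed
  ultimately show ?thesis using lower upper left by blast
qed

definition irregular_children :: "'b \<Rightarrow> 'b set" where
  "irregular_children x = {y \<in> children T x. \<not> well_formed F (cmp t y)}"

text \<open>The sets on the right correspond to the ways in which \<open>x\<close> gets into the
  stain of \<open>u\<close>: \<open>mn t u = x\<close>; \<open>mn t v = x\<close> for a child
  \<open>v\<close> of \<open>u\<close>; an arc from \<open>u\<close> that leaves or enters
  \<open>cmp t x\<close>; an arc from \<open>u\<close> that leaves \<open>cmp t y\<close> for a
  child \<open>y\<close> of \<open>x\<close>.\<close>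

lemma stains_through_subset:
  assumes "x \<in> pverts T"
  shows "{u \<in> V. x \<in> stain t F u} \<subseteq>
    bag t x \<union> (\<Union>v\<in>bag t x. parents F v) \<union>
    (\<Union>A\<in>MF F (cmp t x). F.out_verts A) \<union> (\<Union>A\<in>MF F (cmp t x). F.in_verts A) \<union>
    (\<Union>y\<in>irregular_children x. \<Union>A\<in>MF F (cmp t y). F.out_verts A)"
    (is "_ \<subseteq> ?bound")
proof
  fix u assume "u \<in> {u \<in> V. x \<in> stain t F u}"
  then have u: "u \<in> V" "x \<in> stain t F u" by auto
  show "u \<in> ?bound"
  proof (cases "mn t u = x")
    case True
    then show ?thesis using mn_bag u by blast
  next
    case False
    then obtain v where v: "(u, v) \<in> parcs F" "x \<in> path_verts T (mn t u) (mn t v)"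
      using u by (auto simp: stain_def children_def)
    then have "v \<in> V" using F.in_arcsD2 pverts_F by blast
    have MF_factor: "factor F A \<and> A \<subseteq> U" if "A \<in> MF F U" for A U
      using that by (simp add: MF_def)
    \<comment> \<open>A maximal factor around \<open>u\<close> inside \<open>cmp t y\<close> misses
      \<open>v\<close>, because \<open>v\<close> is outside \<open>cmp t y\<close>.\<close>
    have leave: "\<exists>A\<in>MF F (cmp t y). factor F A \<and> u \<in> A \<and> v \<notin> A"
      if y: "mn t u \<in> descendants T y" "mn t v \<notin> descendants T y" for y
    proof -
      have "u \<in> cmp t y" using y cmp_iff[OF u(1)] by simp
      then obtain A where "A \<in> MF F (cmp t y)" "u \<in> A"
        by (rule F.MF_cover[OF _ cmp_subset])
      then show ?thesis using MF_factor y cmp_iff[OF \<open>v \<in> V\<close>] by blast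
    qed
    have "mn t u \<in> pverts T" "mn t v \<in> pverts T" using mn_mrg u \<open>v \<in> V\<close> by auto
    with v(2) show ?thesis
    proof (cases rule: path_cases)
      case lower
      then obtain A where A: "A \<in> MF F (cmp t x)" "u \<in> A" "v \<notin> A" using leave by blast
      then have "u \<in> F.out_verts A" using v(1) by (auto simp: F.out_verts_def)
      then show ?thesis using A(1) by blast
    next
      case upper
      have "v \<in> cmp t x" using upper cmp_iff[OF \<open>v \<in> V\<close>] by simp
      then obtain A where A: "A \<in> MF F (cmp t x)" "v \<in> A"
        by (rule F.MF_cover[OF _ cmp_subset])
      moreover have "u \<notin> A" using MF_factor A(1) upper cmp_iff[OF u(1)] by blast
      ultimately have "u \<in> F.in_verts A" using v(1) by (auto simp: F.in_verts_def)
      then show ?thesis using A(1) by blast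
    next
      case left
      then show ?thesis using False by simp
    next
      case right
      then show ?thesis using mn_bag[OF \<open>v \<in> V\<close>] v(1) by (auto simp: parents_def)
    next
      case (child y)
      then obtain A where A: "A \<in> MF F (cmp t y)" "factor F A" "u \<in> A" "v \<notin> A"
        using leave by blast
      \<comment> \<open>The arc to \<open>v\<close> leaves the maximal factor \<open>A\<close>, so
        \<open>A\<close> witnesses that \<open>cmp t y\<close> is not well-formed.\<close>
      then have "context_factor F A" using F.leaving_arc_context v(1) by blast
      then have "y \<in> irregular_children x"
        using A(1) child(1) by (auto simp: irregular_children_def well_formed_def)
      moreover have "u \<in> F.out_verts A" using A v(1) by (auto simp: F.out_verts_def)
      ultimately show ?thesis using A(1) by blast
    qed
  qed
qed

section \<open>The number of stains through a node\<close>

lemma card_bag: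
  assumes "x \<in> pverts T"
  shows "card (bag t x) \<le> nat (tw t + 1)"
proof -
  \<comment> \<open>This also gives \<open>tw t + 1 \<ge> 0\<close> when the width is -1, so
    \<open>nat\<close> does not truncate.\<close>
  have "int (card (bag t x)) - 1 \<le> tw t"
    unfolding tw_def using assms T.pair_finite_verts by (intro Max_ge) auto
  then show ?thesis by linarith
qed

lemma card_MF: "x \<in> pverts T \<Longrightarrow> card (MF F (cmp t x)) \<le> split t F"
  unfolding split_def using T.pair_finite_verts by (intro Max_ge) auto

lemma card_irregular: "x \<in> pverts T \<Longrightarrow> card (irregular_children x) \<le> mir t F"
  unfolding mir_def irregularity_def[symmetric] irregular_children_def
  using T.pair_finite_verts by (intro Max_ge) auto

text \<open>The summands account for a bag and the parents in \<open>F\<close> of its vertices, for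
  one tail of leaving and one of entering arcs per maximal factor of \<open>cmp t x\<close>, and for
  one tail per maximal factor at each irregular child.\<close>

definition stain_bound :: nat where
  "stain_bound = 2 * nat (tw t + 1) + 2 * split t F + mir t F * split t F"

lemma card_stains_through:
  assumes x: "x \<in> pverts T"
  shows "card {u \<in> V. x \<in> stain t F u} \<le> stain_bound"
proof -
  let ?B = "bag t x" and ?P = "\<Union>v\<in>bag t x. parents F v"
  let ?O = "\<lambda>y. \<Union>A\<in>MF F (cmp t y). F.out_verts A"
  let ?I = "\<Union>A\<in>MF F (cmp t x). F.in_verts A"
  let ?C = "\<Union>y\<in>irregular_children x. ?O y"
  have fin_bag: "finite ?B" using bag_subset[OF x] finite_V finite_subset by blast
  have parents: "card (parents F v) \<le> 1" for v
  proof -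
    obtain u where "parents F v \<subseteq> {u}" using F.parent_unique unfolding parents_def by blast
    then show ?thesis using card_mono[of "{u}"] by fastforce
  qed
  have factors: "finite (F.out_verts A) \<and> card (F.out_verts A) \<le> 1"
      "finite (F.in_verts A) \<and> card (F.in_verts A) \<le> 1" if "A \<in> MF F U" for A U
    using that F.out_verts_bound F.in_verts_bound by (auto simp: MF_def)
  have fin_MF: "finite (MF F (cmp t y))" for y using F.finite_MF cmp_subset by blast
  have irr: "irregular_children x \<subseteq> pverts T"
    using T.in_arcsD2 by (auto simp: irregular_children_def children_def)
  then have fin_irr: "finite (irregular_children x)"
    using T.pair_finite_verts finite_subset by blast
  have O: "finite (?O y) \<and> card (?O y) \<le> split t F" if "y \<in> pverts T" for y
    using card_UN_bounded[OF fin_MF card_MF[OF that], of F.out_verts 1] factors fin_MF by auto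
  have I: "card ?I \<le> split t F"
    using card_UN_bounded[OF fin_MF card_MF[OF x], of F.in_verts 1] factors by auto
  have P: "card ?P \<le> nat (tw t + 1)"
    using card_UN_bounded[OF fin_bag card_bag[OF x], of "parents F" 1] parents by simp
  have C: "card ?C \<le> mir t F * split t F"
    using card_UN_bounded[OF fin_irr card_irregular[OF x], of ?O] O irr by blast
  have sub: "?B \<union> ?P \<union> ?O x \<union> ?I \<union> ?C \<subseteq> V"
  proof -
    have "parents F v \<subseteq> V" "F.out_verts A \<subseteq> V" "F.in_verts A \<subseteq> V" for v A
      using F.in_arcsD1 by (auto simp: parents_def F.out_verts_def F.in_verts_def pverts_F)
    then show ?thesis using bag_subset[OF x] by (simp add: UN_subset_iff)
  qed
  have "card {u \<in> V. x \<in> stain t F u} \<le> card (?B \<union> ?P \<union> ?O x \<union> ?I \<union> ?C)"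
    using stains_through_subset[OF x] finite_subset[OF sub finite_V] by (rule card_mono[rotated])
  also have "\<dots> \<le> card ?B + card ?P + card (?O x) + card ?I + card ?C"
    by (intro order_trans[OF card_Un_le] add_right_mono) simp
  also have "\<dots> \<le> stain_bound"
    using card_bag[OF x] P O[OF x] I C unfolding stain_bound_def by linarith
  finally show ?thesis .
qed

section \<open>Colouring by the depth of topmost nodes\<close>

definition top_node :: "'a \<Rightarrow> 'b" where
  "top_node u = (SOME r. r \<in> stain t F u \<and> stain t F u \<subseteq> descendants T r)"

lemma top_node:
  assumes "u \<in> V"
  shows "top_node u \<in> stain t F u \<and> stain t F u \<subseteq> descendants T (top_node u)"
proof -
  have "\<exists>r. r \<in> stain t F u \<and> stain t F u \<subseteq> descendants T r"
    using stain_conn[OF assms] T.conn_in_top by (metis empty_iff)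
  then show ?thesis unfolding top_node_def by (rule someI_ex)
qed

text \<open>Counting ancestors turns the order of the tree into the numeric order that the greedy
  colouring uses.\<close>

definition depth :: "'b \<Rightarrow> nat" where
  "depth x = card {z. x \<in> descendants T z}"

lemma depth_less:
  assumes "y \<in> descendants T x" "x \<noteq> y"
  shows "depth x < depth y"
  unfolding depth_def
proof (rule psubset_card_mono)
  have "{z. y \<in> descendants T z} \<subseteq> pverts T" by (auto simp: T.descendants_iff)
  then show "finite {z. y \<in> descendants T z}" using T.pair_finite_verts finite_subset by blast
  have "y \<in> descendants T y" "x \<notin> descendants T y"
    using assms T.descendants_antisym T.descendants_refl T.descendants_subset by blast+
  then show "{z. x \<in> descendants T z} \<subset> {z. y \<in> descendants T z}"
    using assms T.descendants_trans by blast
qed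

text \<open>Both topmost nodes are ancestors of \<open>z\<close>, hence comparable, and by depth
  that of \<open>v\<close> is the upper one. So \<open>top_node u\<close> lies between
  \<open>top_node v\<close> and \<open>z\<close>, and the stain of \<open>v\<close> is
  convex.\<close>

lemma meeting_stain_contains_top:
  assumes "u \<in> V" "v \<in> V" "z \<in> stain t F u" "z \<in> stain t F v"
    and "depth (top_node v) \<le> depth (top_node u)"
  shows "top_node u \<in> stain t F v"
proof -
  have z: "z \<in> descendants T (top_node u)" "z \<in> descendants T (top_node v)"
    using assms top_node by blast+
  have "top_node u \<in> descendants T (top_node v)"
    using T.descendants_comparable[OF z] depth_less assms(5) by (metis leD)
  then show ?thesis
    using T.conn_in_convex stain_conn top_node z assms by blast
qed

lemma chromatic_number_le: "chromatic_number (conflict_graph H t F) \<le> stain_bound"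
proof -
  define adj where "adj u v \<longleftrightarrow> stain t F u \<inter> stain t F v \<noteq> {}" for u v
  have "card {v \<in> V. v \<noteq> u \<and> adj u v \<and> depth (top_node v) \<le> depth (top_node u)} < stain_bound"
    (is "card ?N < _") if u: "u \<in> V" for u
  proof -
    let ?M = "{v \<in> V. top_node u \<in> stain t F v}"
    have "?N \<subseteq> ?M - {u}"
      unfolding adj_def using meeting_stain_contains_top[OF u] by blast
    \<comment> \<open>The stain of \<open>u\<close> itself passes through \<open>top_node u\<close>;
      this makes the inequality strict.\<close>
    moreover have "u \<in> ?M" using top_node u by blast
    moreover have "finite ?M" using finite_V by simp
    ultimately have "card ?N < card ?M" by (intro psubset_card_mono) auto
    also have "\<dots> \<le> stain_bound"
      using card_stains_through stain_conn[OF u] top_node[OF u] by blast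
    finally show ?thesis .
  qed
  moreover have "symp adj" unfolding adj_def by (auto intro!: sympI)
  ultimately obtain c :: "'a \<Rightarrow> nat" where
    "\<forall>v\<in>V. c v < stain_bound" "\<forall>u\<in>V. \<forall>v\<in>V. u \<noteq> v \<and> adj u v \<longrightarrow> c u \<noteq> c v"
    using greedy_colouring[OF finite_V, of adj "\<lambda>u. depth (top_node u)" stain_bound] by blast
  then have "proper_colouring (conflict_graph H t F) stain_bound c"
    by (auto simp: proper_colouring_def conflict_graph_def adj_def)
  then show ?thesis unfolding chromatic_number_def by (blast intro: Least_le)
qed

end

theorem theorem13:
  shows "\<exists>\<eta> :: nat \<Rightarrow> nat \<Rightarrow> int \<Rightarrow> nat \<Rightarrow> nat.
    (\<forall>s s' m m' w w' r r'. s \<le> s' \<and> m \<le> m' \<and> w \<le> w' \<and> r \<le> r' \<longrightarrow> \<eta> s m w r \<le> \<eta> s' m' w' r') \<and>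
    (\<forall>(H :: 'a hypergraph) (t :: ('a, 'b) tree_decomp) (F :: 'a pair_pre_digraph).
       hypergraph H \<and> tree_decomposition H t \<and> elimination_forest H F \<longrightarrow>
       chromatic_number (conflict_graph H t F) \<le> \<eta> (split t F) (mir t F) (tw t) (hrank H))"
proof (intro exI conjI allI impI)
  \<comment> \<open>This is \<open>stain_bound\<close> as a function of the parameters;
    \<open>nat (w + 1)\<close> is monotone over all integers \<open>w\<close>.\<close>
  let ?\<eta> = "\<lambda>s m w r. 2 * nat (w + 1) + 2 * s + m * s"
  show "?\<eta> s m w r \<le> ?\<eta> s' m' w' r'"
    if "s \<le> s' \<and> m \<le> m' \<and> w \<le> w' \<and> r \<le> r'" for s s' m m' :: nat and w w' :: int and r r' :: nat
    using that by (intro add_mono mult_mono nat_mono) auto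
  fix H :: "'a hypergraph" and t :: "('a, 'b) tree_decomp" and F :: "'a pair_pre_digraph"
  assume "hypergraph H \<and> tree_decomposition H t \<and> elimination_forest H F"
  then interpret decomposition H t F by unfold_locales auto
  show "chromatic_number (conflict_graph H t F) \<le> ?\<eta> (split t F) (mir t F) (tw t) (hrank H)"
    using chromatic_number_le by (simp add: stain_bound_def)
qed

end
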